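(* Let $r\ge 1$ and let $T:S_n(\mathbb{R})\to S_n(\mathbb{R})$ be the linear transformation $T(A)=\sum_{k=1}^r\operatorname{tr}(AB_k)U_k$, where $B_1,\ldots,B_r\in S_n(\mathbb{R})$ and $U_1,\ldots,U_r\in S_n(\mathbb{R})$ are linearly independent and all positive definite. Suppose that there exists an invertible real $n\times n$ matrix $W$ such that $WU_kW^t=\operatorname{diag}(\lambda_{1k},\lambda_{2k},\ldots,\lambda_{nk})$ for all $k=1,2,\ldots,r$. Then $T$ is positive definite preserving if and only if the matrices $\sum_{k=1}^r\lambda_{ik}B_k$, $i=1,\ldots,n$, are all non-zero and positive semi-definite.
   Context: $S_n(\mathbb{R})$ is the real vector space of real symmetric $n\times n$ matrices. A linear transformation $T:S_n(\mathbb{R})\to S_n(\mathbb{R})$ is called positive definite preserving if $T(A)$ is positive definite whenever $A\in S_n(\mathbb{R})$ is positive definite. *)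

theory Defs
  imports "HOL-Analysis.Analysis"
begin

definition sym_matrices :: "(real ^ 'n ^ 'n) set"
  where "sym_matrices = {A. transpose A = A}"

definition pos_definite :: "real ^ 'n ^ 'n \<Rightarrow> bool"
  where "pos_definite A \<longleftrightarrow> A \<in> sym_matrices \<and> (\<forall>x. x \<noteq> 0 \<longrightarrow> x \<bullet> (A *v x) > 0)"

definition pos_semidefinite :: "real ^ 'n ^ 'n \<Rightarrow> bool"
  where "pos_semidefinite A \<longleftrightarrow> A \<in> sym_matrices \<and> (\<forall>x. x \<bullet> (A *v x) \<ge> 0)"

definition diag_matrix :: "('n \<Rightarrow> real) \<Rightarrow> real ^ 'n ^ 'n"
  where "diag_matrix d = (\<chi> i j. if i = j then d i else 0)"

(* Linear independence of an indexed family; injectivity is needed because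
   independence of the image alone would not see repeated members. *)
definition independent_family :: "'i set \<Rightarrow> ('i \<Rightarrow> 'a::real_vector) \<Rightarrow> bool"
  where "independent_family I U \<longleftrightarrow> inj_on U I \<and> independent (U ` I)"

(* A map on symmetric matrices is represented by a map on all square matrices,
   of which only the values on sym_matrices matter. *)
definition pos_definite_preserving :: "(real ^ 'n ^ 'n \<Rightarrow> real ^ 'n ^ 'n) \<Rightarrow> bool"
  where "pos_definite_preserving T \<longleftrightarrow>
    (\<forall>A \<in> sym_matrices. pos_definite A \<longrightarrow> pos_definite (T A))"

end

theory Submission
  imports Defs
begin

text \<open>
  Congruence by \<open>W\<close> turns \<open>T A\<close> into the diagonal matrix with entries \<open>tr (A C\<^sub>i)\<close>, where
  \<open>C\<^sub>i = \<Sum>\<^sub>k \<lambda>\<^sub>i\<^sub>k B\<^sub>k\<close>; hence \<open>T A\<close> is positive definite iff all these traces are positive.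
  So everything reduces to one symmetric matrix \<open>C\<close>: \<open>tr (A C) > 0\<close> for all positive definite \<open>A\<close>
  iff \<open>C\<close> is non-zero and positive semidefinite. One direction tests \<open>C\<close> against
  \<open>A = x x\<^sup>t + e I\<close> with \<open>e \<rightarrow> 0\<close>. For the other, symmetric Gaussian elimination peels rank one
  matrices \<open>v v\<^sup>t\<close> off \<open>C\<close>, each contributing a positive multiple of \<open>v \<bullet> A v > 0\<close>.
\<close>

section \<open>Rank one matrices, traces and symmetric matrices\<close>

definition outer :: "real ^ 'n \<Rightarrow> real ^ 'n ^ 'n"
  where "outer v = (\<chi> i j. v $ i * v $ j)"

lemma outer_mult_vec: "outer v *v x = (v \<bullet> x) *\<^sub>R v"
  by (simp add: outer_def matrix_vector_mult_def inner_vec_def vec_eq_iff sum_distrib_left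
      mult_ac)

lemma trace_mult_outer: "trace (A ** outer v) = v \<bullet> (A *v v)"
  by (simp add: trace_def outer_def matrix_matrix_mult_def matrix_vector_mult_def inner_vec_def
      sum_distrib_left mult_ac)

lemma outer_sym: "outer v \<in> sym_matrices"
  by (simp add: sym_matrices_def outer_def transpose_def vec_eq_iff mult.commute)

lemma matrix_add_rdistrib: "(A + B) ** C = A ** C + B ** C" for A B C :: "real ^ 'n ^ 'n"
  by (simp add: matrix_matrix_mult_def vec_eq_iff sum.distrib distrib_right)

lemma trace_scaleR: "trace (c *\<^sub>R A) = c * trace A" for A :: "real ^ 'n ^ 'n"
  by (simp add: trace_def sum_distrib_left)

lemma sym_matrices_add: "A \<in> sym_matrices \<Longrightarrow> B \<in> sym_matrices \<Longrightarrow> A + B \<in> sym_matrices"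
  by (simp add: sym_matrices_def transpose_def vec_eq_iff)

lemma sym_matrices_scaleR: "A \<in> sym_matrices \<Longrightarrow> c *\<^sub>R A \<in> sym_matrices"
  by (simp add: sym_matrices_def transpose_def vec_eq_iff)

lemma sym_matrices_sum: "(\<And>k. k \<in> I \<Longrightarrow> A k \<in> sym_matrices) \<Longrightarrow> sum A I \<in> sym_matrices"
  by (simp add: sym_matrices_def transpose_def vec_eq_iff)

lemma sym_matrices_inner:
  assumes "A \<in> sym_matrices"
  shows "x \<bullet> (A *v y) = y \<bullet> (A *v x)"
proof -
  have "transpose A = A" using assms by (simp add: sym_matrices_def)
  then have "x v* A = A *v x" by (metis transpose_matrix_vector)
  then show ?thesis by (metis dot_lmul_matrix inner_commute)
qed

section \<open>Quadratic forms along a line, and symmetric elimination\<close>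

lemma sym_matrices_quadratic_shift:
  assumes "C \<in> sym_matrices"
  shows "(x + t *\<^sub>R y) \<bullet> (C *v (x + t *\<^sub>R y)) =
    x \<bullet> (C *v x) + 2 * t * (y \<bullet> (C *v x)) + t\<^sup>2 * (y \<bullet> (C *v y))"
  using sym_matrices_inner[OF assms, of x y]
  by (simp add: inner_add_left inner_add_right matrix_vector_right_distrib
      matrix_vector_mult_scaleR power2_eq_square algebra_simps)

lemma axis_inner_mult_vec: "axis i 1 \<bullet> (C *v x) = row i C \<bullet> (x :: real ^ 'n)"
  by (simp add: inner_axis' matrix_vector_mul_component row_def)

lemma axis_quadratic: "axis i 1 \<bullet> (C *v axis i 1) = (C :: real ^ 'n ^ 'n) $ i $ i"
  by (simp add: axis_inner_mult_vec inner_axis row_def)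

text \<open>Along \<open>row i C + t *\<^sub>R axis i 1\<close> the quadratic form loses its
  \<open>t\<^sup>2\<close> term, whose coefficient is \<open>C $ i $ i\<close>. What remains is
  affine in \<open>t\<close> with slope \<open>2 * (row i C \<bullet> row i C)\<close>; being
  nonnegative for all \<open>t\<close>, it has slope 0.\<close>

lemma pos_semidefinite_row_eq_0:
  assumes C: "pos_semidefinite C" and 0: "C $ i $ i = 0"
  shows "row i C = 0"
proof -
  let ?v = "row i C" and ?s = "row i C \<bullet> row i C"
  have sym: "C \<in> sym_matrices" using C by (simp add: pos_semidefinite_def)
  have nn: "0 \<le> ?v \<bullet> (C *v ?v) + 2 * t * ?s" for t
  proof -
    have "0 \<le> (?v + t *\<^sub>R axis i 1) \<bullet> (C *v (?v + t *\<^sub>R axis i 1))"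
      using C by (simp add: pos_semidefinite_def)
    then show ?thesis
      unfolding sym_matrices_quadratic_shift[OF sym] axis_quadratic axis_inner_mult_vec
      by (simp add: inner_axis row_def 0)
  qed
  have "?s = 0"
  proof (rule ccontr)
    assume "?s \<noteq> 0"
    \<comment> \<open>This \<open>t\<close> gives the affine function the value -1.\<close>
    then show False using nn[of "- (?v \<bullet> (C *v ?v) + 1) / (2 * ?s)"] by (simp add: field_simps)
  qed
  then show ?thesis by simp
qed

text \<open>Induction on the number of nonzero diagonal entries: eliminating a nonzero pivot clears
  it and creates no new one. The weak inequality is included because the remainder after elimination
  may be zero.\<close>

lemma trace_mult_pos_semidefinite:
  assumes A: "pos_definite A"
  shows "pos_semidefinite C \<Longrightarrow> trace (A ** C) \<ge> 0 \<and> (C \<noteq> 0 \<longrightarrow> trace (A ** C) > 0)"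
proof (induction "card {i. C $ i $ i \<noteq> 0}" arbitrary: C rule: less_induct)
  case less
  have sym: "C \<in> sym_matrices" and nn: "\<And>x. 0 \<le> x \<bullet> (C *v x)"
    using less.prems by (auto simp: pos_semidefinite_def)
  show ?case
  proof (cases "C = 0")
    case True
    then show ?thesis by (simp add: trace_def)
  next
    case False
    then obtain i where "row i C \<noteq> 0"
      by (auto simp: vec_eq_iff row_def)
    then have i: "C $ i $ i \<noteq> 0" and v: "row i C \<noteq> 0"
      using pos_semidefinite_row_eq_0[OF less.prems] by auto
    have "C $ i $ i \<ge> 0" using nn[of "axis i 1"] by (simp only: axis_quadratic)
    with i have c: "C $ i $ i > 0" by simp
    \<comment> \<open>\<open>D\<close> is \<open>C\<close> after elimination with pivot
      \<open>c\<close>: its row and column \<open>i\<close> vanish, and the rest is the Schur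
      complement.\<close>
    define c v D where "c = C $ i $ i" and "v = row i C" and "D = C + (- (1 / c)) *\<^sub>R outer v"
    have vi: "v \<bullet> axis i 1 = c" by (simp add: v_def c_def inner_axis row_def)
    have "0 \<le> x \<bullet> (D *v x)" for x
    proof -
      \<comment> \<open>Completing the square: this shift minimises the form of \<open>C\<close> on
        the line through \<open>x\<close> in direction \<open>axis i 1\<close>, and the minimum is
        the form of \<open>D\<close> at \<open>x\<close>.\<close>
      have "0 \<le> (x + (- (v \<bullet> x) / c) *\<^sub>R axis i 1) \<bullet> (C *v (x + (- (v \<bullet> x) / c) *\<^sub>R axis i 1))"
        by (rule nn)
      also have "\<dots> = x \<bullet> (C *v x) - (v \<bullet> x)\<^sup>2 / c"
        unfolding sym_matrices_quadratic_shift[OF sym] axis_quadratic axis_inner_mult_vec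
        using c by (simp add: c_def[symmetric] v_def[symmetric] vi field_simps power2_eq_square)
      also have "\<dots> = x \<bullet> (D *v x)"
        by (simp only: D_def matrix_vector_mult_add_rdistrib scaleR_matrix_vector_assoc[symmetric])
          (simp add: outer_mult_vec inner_add_right inner_diff_right power2_eq_square inner_commute)
      finally show ?thesis .
    qed
    moreover have "D \<in> sym_matrices"
      unfolding D_def by (intro sym_matrices_add sym_matrices_scaleR sym outer_sym)
    ultimately have D: "pos_semidefinite D" by (simp add: pos_semidefinite_def)
    \<comment> \<open>A zero diagonal entry forces row \<open>j\<close> of \<open>C\<close> to
      vanish, so by symmetry \<open>v $ j = 0\<close> and the elimination leaves this entry
      alone.\<close>
    have "D $ j $ j = 0" if "C $ j $ j = 0" for j
    proof -
      have "row j C $ i = 0" using pos_semidefinite_row_eq_0[OF less.prems that] by simp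
      moreover have "C $ j $ i = C $ i $ j"
        using sym by (auto simp: sym_matrices_def transpose_def vec_eq_iff)
      ultimately show ?thesis using that by (simp add: D_def outer_def v_def row_def)
    qed
    moreover have "D $ i $ i = 0"
      using c by (simp add: D_def outer_def v_def row_def c_def)
    ultimately have "{j. D $ j $ j \<noteq> 0} \<subset> {j. C $ j $ j \<noteq> 0}" using i by auto
    then have "card {j. D $ j $ j \<noteq> 0} < card {j. C $ j $ j \<noteq> 0}"
      by (intro psubset_card_mono) auto
    from less.hyps[OF this D] have "0 \<le> trace (A ** D)" by simp
    moreover have "C = D + (1 / c) *\<^sub>R outer v" by (simp add: D_def)
    then have "trace (A ** C) = trace (A ** D) + (v \<bullet> (A *v v)) / c"
      by (simp add: matrix_add_ldistrib trace_add matrix_scalar_ac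
            scalar_matrix_assoc[symmetric] trace_scaleR trace_mult_outer)
    moreover have "0 < (v \<bullet> (A *v v)) / c"
      using A v c by (auto simp: pos_definite_def v_def c_def)
    ultimately show ?thesis by linarith
  qed
qed

section \<open>Test matrices and the trace criterion for one matrix\<close>

lemma pos_definite_outer_add_scaleR_mat:
  assumes "e > 0"
  shows "pos_definite (outer x + e *\<^sub>R mat 1)"
proof -
  have "(mat 1 :: real ^ 'n ^ 'n) \<in> sym_matrices" by (simp add: sym_matrices_def)
  moreover have "0 < y \<bullet> ((outer x + e *\<^sub>R mat 1) *v y)" if "y \<noteq> 0" for y
  proof -
    have "y \<bullet> ((outer x + e *\<^sub>R mat 1) *v y) = (x \<bullet> y)\<^sup>2 + e * (y \<bullet> y)"
      by (simp add: matrix_vector_mult_add_rdistrib scaleR_matrix_vector_assoc[symmetric]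
            outer_mult_vec inner_add_right power2_eq_square inner_commute)
    moreover have "e * (y \<bullet> y) > 0" using assms that by simp
    ultimately show ?thesis by (simp add: add_nonneg_pos)
  qed
  ultimately show ?thesis
    by (auto simp: pos_definite_def intro!: sym_matrices_add sym_matrices_scaleR outer_sym)
qed

lemma trace_mult_pos_iff:
  assumes C: "C \<in> sym_matrices"
  shows "(\<forall>A. pos_definite A \<longrightarrow> trace (A ** C) > 0) \<longleftrightarrow> C \<noteq> 0 \<and> pos_semidefinite C"
proof
  assume pos: "\<forall>A. pos_definite A \<longrightarrow> trace (A ** C) > 0"
  have "C \<noteq> 0"
    \<comment> \<open>The test matrix here is the identity; \<open>C = 0\<close> would make its
      trace 0.\<close>
    using pos pos_definite_outer_add_scaleR_mat[of 1 0] by (fastforce simp: trace_def)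
  moreover have "0 \<le> x \<bullet> (C *v x)" for x
  proof -
    have "0 \<le> x \<bullet> (C *v x) + e * trace C" if "e > 0" for e
    proof -
      have "trace ((outer x + e *\<^sub>R mat 1) ** C) = x \<bullet> (C *v x) + e * trace C"
        by (simp add: matrix_add_rdistrib trace_add trace_mul_sym[of "outer x" C]
            trace_mult_outer trace_scaleR scalar_matrix_assoc[symmetric])
      then show ?thesis
        using pos pos_definite_outer_add_scaleR_mat[OF that, of x] by (metis less_imp_le)
    qed
    then have "\<forall>\<^sub>F e in at_right 0. 0 \<le> x \<bullet> (C *v x) + e * trace C"
      by (auto simp: eventually_at_filter)
    moreover have "((\<lambda>e. x \<bullet> (C *v x) + e * trace C) \<longlongrightarrow> x \<bullet> (C *v x) + 0 * trace C) (at_right 0)"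
      by (intro tendsto_intros)
    ultimately have "0 \<le> x \<bullet> (C *v x) + 0 * trace C"
      by (intro tendsto_lowerbound) auto
    then show ?thesis by simp
  qed
  ultimately show "C \<noteq> 0 \<and> pos_semidefinite C"
    using C by (simp add: pos_semidefinite_def)
qed (simp add: trace_mult_pos_semidefinite)

section \<open>Diagonal matrices and congruence\<close>

lemma diag_matrix_quadratic: "x \<bullet> (diag_matrix d *v x) = (\<Sum>i\<in>UNIV. d i * (x $ i)\<^sup>2)"
proof -
  have "diag_matrix d *v x = (\<chi> i. d i * x $ i)"
    by (simp add: diag_matrix_def matrix_vector_mult_def mult_delta_left)
  then show ?thesis by (simp add: inner_vec_def power2_eq_square mult_ac)
qed

text \<open>The substitution \<open>y = transpose W *v x\<close> is a bijection carrying the form of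
  \<open>M\<close> to the weighted sum of squares with weights \<open>d i\<close>.\<close>

lemma pos_definite_congruent_diag_iff:
  assumes M: "M \<in> sym_matrices" and W: "invertible W"
    and eq: "W ** M ** transpose W = diag_matrix d"
  shows "pos_definite M \<longleftrightarrow> (\<forall>i. d i > 0)"
proof -
  have q: "(transpose W *v x) \<bullet> (M *v (transpose W *v x)) = (\<Sum>i\<in>UNIV. d i * (x $ i)\<^sup>2)" for x
  proof -
    have "(transpose W *v x) \<bullet> (M *v (transpose W *v x)) = x \<bullet> (diag_matrix d *v x)"
      by (simp add: eq[symmetric] dot_lmul_matrix transpose_matrix_vector
          flip: matrix_vector_mul_assoc)
    then show ?thesis by (simp add: diag_matrix_quadratic)
  qed
  obtain V where V: "V ** W = mat 1" "W ** V = mat 1" using W by (auto simp: invertible_def)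
  then have V': "transpose W ** transpose V = mat 1" "transpose V ** transpose W = mat 1"
    by (simp_all flip: matrix_transpose_mul)
  show ?thesis
  proof
    assume pd: "pos_definite M"
    show "\<forall>i. d i > 0"
    proof
      fix i
      \<comment> \<open>The vector to test is the image of \<open>axis i 1\<close>, nonzero since
        \<open>transpose V\<close> undoes \<open>transpose W\<close>; the form of \<open>M\<close>
        there is \<open>d i\<close>.\<close>
      have "transpose V *v (transpose W *v axis i (1::real)) = axis i 1"
        by (simp only: matrix_vector_mul_assoc V' matrix_vector_mul_lid)
      then have "transpose W *v axis i (1::real) \<noteq> 0"
        by (metis axis_eq_0_iff matrix_vector_mult_0_right zero_neq_one)
      then have "0 < (\<Sum>j\<in>UNIV. d j * (axis i (1::real) $ j)\<^sup>2)"
        using pd unfolding pos_definite_def q[symmetric] by blast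
      also have "\<dots> = (\<Sum>j\<in>UNIV. if j = i then d j else 0)"
        by (intro sum.cong) (auto simp: axis_def)
      finally show "d i > 0" by simp
    qed
  next
    assume d: "\<forall>i. d i > 0"
    have "0 < y \<bullet> (M *v y)" if "y \<noteq> 0" for y
    proof -
      define x where "x = transpose V *v y"
      have y: "y = transpose W *v x"
        by (simp only: x_def matrix_vector_mul_assoc V' matrix_vector_mul_lid)
      with that obtain i where "x $ i \<noteq> 0" by (metis matrix_vector_mult_0_right vec_eq_iff zero_index)
      then have "0 < (\<Sum>i\<in>UNIV. d i * (x $ i)\<^sup>2)"
        using d by (intro sum_pos2[of _ i]) (auto intro!: mult_nonneg_nonneg less_imp_le[of 0 "d _"])
      then show ?thesis by (simp only: y q)
    qed
    then show "pos_definite M" using M by (simp add: pos_definite_def)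
  qed
qed

theorem theorem3p3:
  fixes r :: nat
    and T :: "real ^ 'n ^ 'n \<Rightarrow> real ^ 'n ^ 'n"
    and B U :: "nat \<Rightarrow> real ^ 'n ^ 'n"
    and lam :: "'n \<Rightarrow> nat \<Rightarrow> real"
  assumes "r \<ge> 1"
    and "\<forall>k\<in>{1..r}. B k \<in> sym_matrices"
    and "\<forall>k\<in>{1..r}. U k \<in> sym_matrices"
    and "independent_family {1..r} U"
    and "\<forall>k\<in>{1..r}. pos_definite (U k)"
    and "\<forall>A\<in>sym_matrices. T A = (\<Sum>k=1..r. trace (A ** B k) *\<^sub>R U k)"
    and "\<exists>W :: real ^ 'n ^ 'n. invertible W \<and>
           (\<forall>k\<in>{1..r}. W ** U k ** transpose W = diag_matrix (\<lambda>i. lam i k))"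
  shows "pos_definite_preserving T \<longleftrightarrow>
    (\<forall>i. (\<Sum>k=1..r. lam i k *\<^sub>R B k) \<noteq> 0 \<and>
         pos_semidefinite (\<Sum>k=1..r. lam i k *\<^sub>R B k))"
proof -
  define C where "C i = (\<Sum>k=1..r. lam i k *\<^sub>R B k)" for i
  have C: "C i \<in> sym_matrices" for i
    unfolding C_def using assms(2) by (intro sym_matrices_sum sym_matrices_scaleR) auto
  obtain W :: "real ^ 'n ^ 'n" where W: "invertible W"
    and WU: "\<And>k. k \<in> {1..r} \<Longrightarrow> W ** U k ** transpose W = diag_matrix (\<lambda>i. lam i k)"
    using assms(7) by blast
  have key: "pos_definite (T A) \<longleftrightarrow> (\<forall>i. trace (A ** C i) > 0)" if A: "A \<in> sym_matrices" for A
  proof (rule pos_definite_congruent_diag_iff[OF _ W])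
    have T: "T A = (\<Sum>k=1..r. trace (A ** B k) *\<^sub>R U k)" using assms(6) A by blast
    show "T A \<in> sym_matrices"
      unfolding T using assms(3) by (intro sym_matrices_sum sym_matrices_scaleR) auto
    \<comment> \<open>Congruence by the fixed \<open>W\<close> is linear, so it diagonalises all
      summands of \<open>T A\<close> at once.\<close>
    have "linear (\<lambda>X. W ** X ** transpose W)"
      by (auto intro!: linearI simp: matrix_add_ldistrib matrix_add_rdistrib
          matrix_scalar_ac scalar_matrix_assoc[symmetric])
    then have "W ** T A ** transpose W =
        (\<Sum>k=1..r. trace (A ** B k) *\<^sub>R (W ** U k ** transpose W))"
      unfolding T by (simp only: linear_sum[of "\<lambda>X. W ** X ** transpose W"]
          linear_scale[of "\<lambda>X. W ** X ** transpose W"])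
    also have "\<dots> = (\<Sum>k=1..r. trace (A ** B k) *\<^sub>R diag_matrix (\<lambda>i. lam i k))"
      by (intro sum.cong refl) (simp only: WU)
    also have "\<dots> = diag_matrix (\<lambda>i. \<Sum>k=1..r. lam i k * trace (A ** B k))"
      by (simp add: diag_matrix_def vec_eq_iff mult.commute)
    also have "(\<lambda>i. \<Sum>k=1..r. lam i k * trace (A ** B k)) = (\<lambda>i. trace (A ** C i))"
    proof
      fix i
      have "linear (\<lambda>X. trace (A ** X))"
        by (auto intro!: linearI simp: matrix_add_ldistrib trace_add matrix_scalar_ac
            scalar_matrix_assoc[symmetric] trace_scaleR)
      then show "(\<Sum>k=1..r. lam i k * trace (A ** B k)) = trace (A ** C i)"
        unfolding C_def
        by (simp add: linear_sum[of "\<lambda>X. trace (A ** X)"] linear_scale[of "\<lambda>X. trace (A ** X)"])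
    qed
    finally show "W ** T A ** transpose W = diag_matrix (\<lambda>i. trace (A ** C i))" .
  qed
  \<comment> \<open>The quantifiers over \<open>A\<close> and \<open>i\<close> commute, so the
    criterion for one matrix applies to each \<open>C i\<close> separately.\<close>
  have "pos_definite_preserving T \<longleftrightarrow> (\<forall>i A. pos_definite A \<longrightarrow> trace (A ** C i) > 0)"
    unfolding pos_definite_preserving_def using key by (auto simp: pos_definite_def)
  then show ?thesis
    unfolding C_def[symmetric] trace_mult_pos_iff[OF C, symmetric] .
qed

end
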